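(* For every integer $n\ge0$, $$P_{010}(n)=\sum_{j,k\ge0}q^{j^2+k^2}{2n-k\brack j}_{q^2}{j\brack k}_{q^2}.$$
   Context: For partitions $\lambda=(\lambda_1,\lambda_2,\dots)$, $\mu=(\mu_1,\mu_2,\dots)$ (weakly decreasing, padded by zeros) write $\lambda\succeq\mu$ if $\lambda_1\ge\mu_1\ge\lambda_2\ge\mu_2\ge\cdots$ and $\lambda\preceq\mu$ if $\mu_1\ge\lambda_1\ge\mu_2\ge\lambda_2\ge\cdots$. A skew double shifted plane partition (DSPP) with profile $\delta=\delta_1\delta_2\delta_3\in\{0,1\}^3$ is a 4-tuple of integer partitions $(\lambda^0,\lambda^1,\lambda^2,\lambda^3)$ with $\lambda^{j-1}\succeq\lambda^j$ if $\delta_j=0$ and $\lambda^{j-1}\preceq\lambda^j$ if $\delta_j=1$ ($j=1,2,3$). Its size $|\Lambda|$ is the sum of all parts of the four partitions; its diagonal length is the maximum of the numbers of (positive) parts of the four partitions. Let $\mathrm{DSPP}_{010}(n)$ be the set of DSPPs with profile $010$ and diagonal length at most $n$, $F_{010}(n)=\sum_{\Lambda\in\mathrm{DSPP}_{010}(n)}q^{|\Lambda|}$, and $P_{010}(n)=(q;q)_{4n}F_{010}(n)$. Here $(a;q)_0=1$, $(a;q)_n=\prod_{i=0}^{n-1}(1-aq^i)$, and ${n\brack m}_q=\frac{(q;q)_n}{(q;q)_m(q;q)_{n-m}}$ if $n\ge m\ge0$ and $0$ otherwise; ${n\brack m}_{q^2}$ is the same with $q\to q^2$. *)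

theory Defs
  imports
    "HOL-Analysis.Infinite_Sum"
    "HOL-Computational_Algebra.Formal_Power_Series"
    "HOL-Library.Z2"
begin

(* The part lambda_i of a partition is p (i - 1): parts are indexed from 0 and padded by zeros. *)
definition is_partition :: "(nat \<Rightarrow> nat) \<Rightarrow> bool" where
  "is_partition p \<longleftrightarrow> antimono p \<and> finite {i. p i > 0}"

definition num_parts :: "(nat \<Rightarrow> nat) \<Rightarrow> nat" where
  "num_parts p = card {i. p i > 0}"

definition sum_parts :: "(nat \<Rightarrow> nat) \<Rightarrow> nat" where
  "sum_parts p = (\<Sum>i\<in>{i. p i > 0}. p i)"

definition interlaces :: "(nat \<Rightarrow> nat) \<Rightarrow> (nat \<Rightarrow> nat) \<Rightarrow> bool" where
  "interlaces p r \<longleftrightarrow> (\<forall>i. p i \<ge> r i \<and> r i \<ge> p (Suc i))"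

definition profile_step :: "bit \<Rightarrow> (nat \<Rightarrow> nat) \<Rightarrow> (nat \<Rightarrow> nat) \<Rightarrow> bool" where
  "profile_step d p r \<longleftrightarrow> (if d = 0 then interlaces p r else interlaces r p)"

type_synonym partition4 = "(nat \<Rightarrow> nat) \<times> (nat \<Rightarrow> nat) \<times> (nat \<Rightarrow> nat) \<times> (nat \<Rightarrow> nat)"

fun is_dspp :: "bit \<times> bit \<times> bit \<Rightarrow> partition4 \<Rightarrow> bool" where
  "is_dspp (d1, d2, d3) (p0, p1, p2, p3) \<longleftrightarrow>
     is_partition p0 \<and> is_partition p1 \<and> is_partition p2 \<and> is_partition p3 \<and>
     profile_step d1 p0 p1 \<and> profile_step d2 p1 p2 \<and> profile_step d3 p2 p3"

fun dspp_size :: "partition4 \<Rightarrow> nat" where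
  "dspp_size (p0, p1, p2, p3) = sum_parts p0 + sum_parts p1 + sum_parts p2 + sum_parts p3"

fun diagonal_length :: "partition4 \<Rightarrow> nat" where
  "diagonal_length (p0, p1, p2, p3) =
     Max {num_parts p0, num_parts p1, num_parts p2, num_parts p3}"

definition DSPP :: "bit \<times> bit \<times> bit \<Rightarrow> nat \<Rightarrow> partition4 set" where
  "DSPP \<delta> n = {\<Lambda>. is_dspp \<delta> \<Lambda> \<and> diagonal_length \<Lambda> \<le> n}"

(* The sum of q^(dspp_size L) over L in DSPP, with q = fps_X, collected by powers of q.
   The sets that are counted are finite, see finite_DSPP_size below. *)
definition F_DSPP :: "bit \<times> bit \<times> bit \<Rightarrow> nat \<Rightarrow> rat fps" where
  "F_DSPP \<delta> n = Abs_fps (\<lambda>m. of_nat (card {\<Lambda> \<in> DSPP \<delta> n. dspp_size \<Lambda> = m}))"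

definition q_pochhammer :: "'a::comm_ring_1 \<Rightarrow> 'a \<Rightarrow> nat \<Rightarrow> 'a" where
  "q_pochhammer a q n = (\<Prod>i<n. 1 - a * q ^ i)"

(* The base q ranges over power series with zero constant term, such as fps_X and fps_X^2, so that
   the divisor is a unit. The arguments are integers, since 2n - k may be negative. *)
definition q_binomial :: "rat fps \<Rightarrow> int \<Rightarrow> int \<Rightarrow> rat fps" where
  "q_binomial q n m =
     (if 0 \<le> m \<and> m \<le> n
      then q_pochhammer q q (nat n) /
             (q_pochhammer q q (nat m) * q_pochhammer q q (nat (n - m)))
      else 0)"

definition P_010 :: "nat \<Rightarrow> rat fps" where
  "P_010 n = q_pochhammer fps_X fps_X (4 * n) * F_DSPP (0, 1, 0) n"

lemma finite_DSPP_size: "finite {\<Lambda> \<in> DSPP \<delta> n. dspp_size \<Lambda> = m}"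
proof -
  let ?A = "{p :: nat \<Rightarrow> nat. \<forall>i. (i \<in> {..<n} \<longrightarrow> p i \<in> {..m}) \<and> (i \<notin> {..<n} \<longrightarrow> p i = 0)}"
  have A: "p \<in> ?A" if p: "is_partition p" "num_parts p \<le> n" "sum_parts p \<le> m" for p
  proof -
    have fin: "finite {i. p i > 0}" and anti: "antimono p"
      using p(1) by (auto simp: is_partition_def)
    have "p i = 0" if "i \<ge> n" for i
    proof (rule ccontr)
      assume "p i \<noteq> 0"
      then have "{..i} \<subseteq> {i. p i > 0}"
        using antimonoD[OF anti] by (auto intro: less_le_trans)
      from card_mono[OF fin this] show False
        using p(2) that by (simp add: num_parts_def)
    qed
    moreover have "p i \<le> m" for i
    proof (cases "p i > 0")
      case True
      then have "p i \<le> sum_parts p"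
        unfolding sum_parts_def by (intro member_le_sum) (use fin in auto)
      then show ?thesis using p(3) by simp
    qed simp
    ultimately show ?thesis by auto
  qed
  have "finite ?A" by (rule finite_set_of_finite_funs) auto
  then have "finite (?A \<times> ?A \<times> ?A \<times> ?A)" by (intro finite_cartesian_product)
  moreover have "{\<Lambda> \<in> DSPP \<delta> n. dspp_size \<Lambda> = m} \<subseteq> ?A \<times> ?A \<times> ?A \<times> ?A"
  proof
    fix L assume L: "L \<in> {\<Lambda> \<in> DSPP \<delta> n. dspp_size \<Lambda> = m}"
    obtain p0 p1 p2 p3 where Lp: "L = (p0, p1, p2, p3)" by (cases L) auto
    obtain d1 d2 d3 where d: "\<delta> = (d1, d2, d3)" by (cases \<delta>) auto
    have "p0 \<in> ?A" "p1 \<in> ?A" "p2 \<in> ?A" "p3 \<in> ?A"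
      using L unfolding Lp d DSPP_def by (intro A; simp)+
    then show "L \<in> ?A \<times> ?A \<times> ?A \<times> ?A" unfolding Lp by blast
  qed
  ultimately show ?thesis by (rule finite_subset[rotated])
qed

end

theory Submission
  imports Defs
begin

unbundle fps_syntax

text \<open>
  Both sides of the identity are values, at $N = 2n$, of sequences of polynomials with
  $P_0 = 1$, $P_1 = 1 + q$ and
    $$P_{N+2} = (1 + q^{2N+3}) P_{N+1} + q^{2N+2} P_N.$$

  On the combinatorial side, the parts of a tuple $(\lambda^0, \dots, \lambda^3)$ of profile 010
  are arranged in $2n$ levels of two parts each: level $2i$ consists of the parts with index $i$ of
  $\lambda^2$ (inner) and $\lambda^0$ (outer), level $2i+1$ of those of $\lambda^1$ (inner) and
  $\lambda^3$ (outer). In this arrangement all the interlacing conditions say the same thing at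
  every level: a part is at least as large as each part of the next level, except that outer parts
  of consecutive levels are not compared. So odd numbers of levels make sense too, and $P_N$ is
  $(q;q)_{2N}$ times the generating function of $N$ levels.

  To remove levels, let $A$ be the set of positions. Subtracting 1 from every part is a bijection
  from the fillings with all parts positive to all fillings, so $(1 - q^{|A|})$ times the
  generating function counts the fillings with a part equal to 0. Then also some part at a lowest
  position is 0. If there are at most two lowest positions, inclusion-exclusion over
  which of them carries a zero yields generating functions of smaller sets
  (\<open>weight_gf_two_bottoms\<close>). Starting from $N + 2$ levels, this runs through
  only three intermediate shapes and gives the recurrence (\<open>zigzag_poly_rec\<close>).

  On the side of the double sum, the same recurrence (\<open>double_sum_rec\<close>) comes from applying
  the two $q$-Pascal rules, one to each $q$-binomial coefficient: every term for $N + 2$ is the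
  term with the same indices for $N + 1$, plus $q^{2N+3}$ times the term at $(j-1, k)$ for $N + 1$,
  plus $q^{2N+2}$ times the term at $(j-1, k-1)$ for $N$.
\<close>

section \<open>Order-preserving fillings of a poset\<close>

definition weight :: "('a \<Rightarrow> nat) \<Rightarrow> nat" where
  "weight f = (\<Sum>x | f x > 0. f x)"

definition weight_gf :: "('a \<Rightarrow> nat) set \<Rightarrow> rat fps" where
  "weight_gf S = Abs_fps (\<lambda>m. of_nat (card {f \<in> S. weight f = m}))"

text \<open>
  The P-partitions of the poset generated by \<open>R\<close>, with \<open>(x, y) \<in> R\<close> meaning that
  \<open>x\<close> lies above \<open>y\<close>. The order condition is imposed on the whole type, not only on
  \<open>A\<close>, so that the fillings of \<open>A - {u}\<close> are exactly the fillings of \<open>A\<close> that vanish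
  at \<open>u\<close>.
\<close>

definition poset_partitions :: "('a \<times> 'a) set \<Rightarrow> 'a set \<Rightarrow> ('a \<Rightarrow> nat) set" where
  "poset_partitions R A = {f. (\<forall>(x, y) \<in> R. f y \<le> f x) \<and> (\<forall>x. x \<notin> A \<longrightarrow> f x = 0)}"

definition up_closed :: "('a \<times> 'a) set \<Rightarrow> 'a set \<Rightarrow> bool" where
  "up_closed R A \<longleftrightarrow> (\<forall>(x, y) \<in> R. y \<in> A \<longrightarrow> x \<in> A)"

lemma weight_eq_sum:
  assumes "finite A" "\<And>x. x \<notin> A \<Longrightarrow> f x = 0"
  shows "weight f = sum f A"
  unfolding weight_def
  by (rule sum.mono_neutral_left) (use assms in \<open>auto intro: ccontr\<close>)

lemma finite_poset_partitions_weight: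
  assumes "finite A"
  shows "finite {f \<in> poset_partitions R A. weight f = m}"
proof (rule finite_subset)
  show "{f \<in> poset_partitions R A. weight f = m} \<subseteq>
      {f. \<forall>x. (x \<in> A \<longrightarrow> f x \<in> {..m}) \<and> (x \<notin> A \<longrightarrow> f x = 0)}"
    using assms by (auto simp: poset_partitions_def weight_eq_sum intro!: member_le_sum)
  show "finite {f. \<forall>x. (x \<in> A \<longrightarrow> f x \<in> {..m}) \<and> (x \<notin> A \<longrightarrow> f x = 0)}"
    using assms by (intro finite_set_of_finite_funs) auto
qed

lemma poset_partitions_rtrancl:
  assumes "f \<in> poset_partitions R A" "(x, y) \<in> R\<^sup>*"
  shows "f y \<le> f x"
  using assms(2)
proof induction
  case (step y z)
  then show ?case using assms(1) by (fastforce simp: poset_partitions_def)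
qed simp

text \<open>
  Adding 1 on \<open>A\<close> is a bijection onto the positive fillings. Since outside \<open>A\<close> the values
  stay 0, this respects the order only because nothing outside \<open>A\<close> lies above an element
  of \<open>A\<close>.
\<close>

lemma card_positive_poset_partitions:
  assumes "finite A" "up_closed R A"
  shows "card {f \<in> poset_partitions R A. (\<forall>x\<in>A. f x > 0) \<and> weight f = m + card A} =
         card {f \<in> poset_partitions R A. weight f = m}"
proof -
  let ?up = "\<lambda>f x. f x + (if x \<in> A then 1 else 0 :: nat)"
  let ?down = "\<lambda>f x. f x - (if x \<in> A then 1 else 0 :: nat)"
  have R: "x \<in> A" if "(x, y) \<in> R" "y \<in> A" for x y
    using assms(2) that by (auto simp: up_closed_def)
  have "bij_betw ?up {f \<in> poset_partitions R A. weight f = m}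
          {f \<in> poset_partitions R A. (\<forall>x\<in>A. f x > 0) \<and> weight f = m + card A}"
  proof (rule bij_betwI[where g = ?down])
    show "?up \<in> {f \<in> poset_partitions R A. weight f = m} \<rightarrow>
          {f \<in> poset_partitions R A. (\<forall>x\<in>A. f x > 0) \<and> weight f = m + card A}"
    proof
      fix f assume f: "f \<in> {f \<in> poset_partitions R A. weight f = m}"
      have up: "?up f \<in> poset_partitions R A"
        using f R by (fastforce simp: poset_partitions_def)
      have "sum (?up f) A = sum f A + card A"
        unfolding sum.distrib by simp
      then have "weight (?up f) = weight f + card A"
        using f up assms(1)
        by (subst (1 2) weight_eq_sum[OF assms(1)]) (auto simp: poset_partitions_def)
      then show "?up f \<in> {f \<in> poset_partitions R A. (\<forall>x\<in>A. f x > 0) \<and> weight f = m + card A}"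
        using up f by simp
    qed
    show "?down \<in> {f \<in> poset_partitions R A. (\<forall>x\<in>A. f x > 0) \<and> weight f = m + card A} \<rightarrow>
          {f \<in> poset_partitions R A. weight f = m}"
    proof
      fix f assume f: "f \<in> {f \<in> poset_partitions R A. (\<forall>x\<in>A. f x > 0) \<and> weight f = m + card A}"
      have down: "?down f \<in> poset_partitions R A"
        unfolding poset_partitions_def
      proof (safe, goal_cases)
        case (1 x y)
        have "f y \<le> f x" using f 1 by (auto simp: poset_partitions_def)
        then show ?case using R[OF 1] f by (cases "y \<in> A") (auto simp: poset_partitions_def)
      next
        case (2 x)
        then show ?case using f by (simp add: poset_partitions_def)
      qed
      have "sum f A = sum (\<lambda>x. ?down f x + 1) A"
        using f by (intro sum.cong) auto
      also have "\<dots> = sum (?down f) A + card A"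
        by (subst sum.distrib) simp
      finally have "weight f = weight (?down f) + card A"
        using f down assms(1)
        by (subst (1 2) weight_eq_sum[OF assms(1)]) (auto simp: poset_partitions_def)
      then show "?down f \<in> {f \<in> poset_partitions R A. weight f = m}"
        using down f by simp
    qed
  qed (auto simp: poset_partitions_def fun_eq_iff)
  then show ?thesis by (simp add: bij_betw_same_card)
qed

lemma weight_gf_poset_partitions_vanishing:
  assumes "finite A" "up_closed R A"
  shows "(1 - fps_X ^ card A) * weight_gf (poset_partitions R A) =
         weight_gf {f \<in> poset_partitions R A. \<exists>x\<in>A. f x = 0}"
proof (rule fps_ext)
  fix m
  let ?S = "poset_partitions R A"
  let ?pos = "{f \<in> ?S. (\<forall>x\<in>A. f x > 0) \<and> weight f = m}"
  let ?van = "{f \<in> ?S. (\<exists>x\<in>A. f x = 0) \<and> weight f = m}"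
  have "{f \<in> ?S. weight f = m} = ?pos \<union> ?van" by auto
  moreover have "card (?pos \<union> ?van) = card ?pos + card ?van"
    by (intro card_Un_disjoint
          finite_subset[OF _ finite_poset_partitions_weight[OF assms(1), of R m]]) auto
  ultimately have split: "card {f \<in> ?S. weight f = m} = card ?pos + card ?van" by simp
  have pos: "card ?pos = (if m < card A then 0 else card {f \<in> ?S. weight f = m - card A})"
  proof (cases "m < card A")
    case True
    have "card A \<le> weight f" if "f \<in> ?S" "\<forall>x\<in>A. f x > 0" for f
      using sum_mono[of A "\<lambda>_. 1" f] that assms(1)
      by (subst weight_eq_sum[OF assms(1)]) (auto simp: poset_partitions_def Suc_le_eq)
    then have "?pos = {}" using True by fastforce
    then show ?thesis using True by (simp only: card.empty if_True)
  next
    case False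
    then show ?thesis
      using card_positive_poset_partitions[OF assms, of "m - card A"] by simp
  qed
  have "((1 - fps_X ^ card A) * weight_gf ?S) $ m =
      weight_gf ?S $ m - (fps_X ^ card A * weight_gf ?S) $ m"
    by (simp only: left_diff_distrib mult_1_left fps_sub_nth)
  also have "\<dots> = of_nat (card {f \<in> ?S. weight f = m}) - of_nat (card ?pos)"
    unfolding fps_X_power_mult_nth weight_gf_def fps_nth_Abs_fps pos by simp
  also have "\<dots> = of_nat (card ?van)"
    unfolding split by simp
  finally have "((1 - fps_X ^ card A) * weight_gf ?S) $ m = of_nat (card ?van)" .
  then show "((1 - fps_X ^ card A) * weight_gf ?S) $ m =
      weight_gf {f \<in> ?S. \<exists>x\<in>A. f x = 0} $ m"
    by (simp add: weight_gf_def conj_ac)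
qed

text \<open>
  A filling that vanishes somewhere vanishes at \<open>u\<close> or at \<open>v\<close>, since one of them lies below
  the zero. The fillings that vanish at a given lowest position are those of a smaller set, so
  inclusion-exclusion applies. The case \<open>u = v\<close> is that of a single lowest element.
\<close>

lemma weight_gf_two_bottoms:
  assumes A: "finite A" "up_closed R A" and uv: "u \<in> A" "v \<in> A"
    and below: "\<And>x. x \<in> A \<Longrightarrow> (x, u) \<in> R\<^sup>* \<or> (x, v) \<in> R\<^sup>*"
  shows "(1 - fps_X ^ card A) * weight_gf (poset_partitions R A) =
         weight_gf (poset_partitions R (A - {u})) + weight_gf (poset_partitions R (A - {v})) -
         weight_gf (poset_partitions R (A - {u, v}))"
proof -
  let ?S = "poset_partitions R A"
  let ?U = "\<lambda>u. poset_partitions R (A - {u})"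
  have U: "?U u = {f \<in> ?S. f u = 0}" for u
    by (auto simp: poset_partitions_def)
  have inter: "poset_partitions R (A - {u, v}) = {f \<in> ?S. f u = 0 \<and> f v = 0}"
    by (auto simp: poset_partitions_def)
  have van: "{f \<in> ?S. \<exists>x\<in>A. f x = 0} = {f \<in> ?S. f u = 0 \<or> f v = 0}"
  proof (intro equalityI subsetI)
    fix f assume "f \<in> {f \<in> ?S. \<exists>x\<in>A. f x = 0}"
    then obtain x where f: "f \<in> ?S" and x: "x \<in> A" "f x = 0" by auto
    have "f u \<le> f x \<or> f v \<le> f x"
      using below[OF x(1)] poset_partitions_rtrancl[OF f] by blast
    then show "f \<in> {f \<in> ?S. f u = 0 \<or> f v = 0}" using f x by auto
  qed (use uv in auto)
  have "weight_gf {f \<in> ?S. f u = 0 \<or> f v = 0} + weight_gf {f \<in> ?S. f u = 0 \<and> f v = 0} =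
        weight_gf {f \<in> ?S. f u = 0} + weight_gf {f \<in> ?S. f v = 0}"
  proof (rule fps_ext)
    fix m
    let ?D = "\<lambda>w. {f \<in> {f \<in> ?S. f w = 0}. weight f = m}"
    have fin: "finite (?D w)" for w
      by (rule finite_subset[OF _ finite_poset_partitions_weight[OF A(1), of R m]]) auto
    have "card (?D u) + card (?D v) = card (?D u \<union> ?D v) + card (?D u \<inter> ?D v)"
      by (rule card_Un_Int[OF fin fin])
    moreover have "?D u \<union> ?D v = {f \<in> {f \<in> ?S. f u = 0 \<or> f v = 0}. weight f = m}" by auto
    moreover have "?D u \<inter> ?D v = {f \<in> {f \<in> ?S. f u = 0 \<and> f v = 0}. weight f = m}" by auto
    ultimately show "(weight_gf {f \<in> ?S. f u = 0 \<or> f v = 0} +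
          weight_gf {f \<in> ?S. f u = 0 \<and> f v = 0}) $ m =
        (weight_gf {f \<in> ?S. f u = 0} + weight_gf {f \<in> ?S. f v = 0}) $ m"
      unfolding weight_gf_def fps_add_nth fps_nth_Abs_fps by (simp flip: of_nat_add)
  qed
  then show ?thesis
    unfolding weight_gf_poset_partitions_vanishing[OF A] van U inter
    by (simp add: algebra_simps)
qed

lemma weight_gf_one_bottom:
  assumes "finite A" "up_closed R A" "u \<in> A" "\<And>x. x \<in> A \<Longrightarrow> (x, u) \<in> R\<^sup>*"
  shows "(1 - fps_X ^ card A) * weight_gf (poset_partitions R A) =
         weight_gf (poset_partitions R (A - {u}))"
  using weight_gf_two_bottoms[of A R u u] assms by simp

lemma weight_gf_poset_partitions_empty: "weight_gf (poset_partitions R {}) = 1"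
proof (rule fps_ext)
  fix m
  have "poset_partitions R {} = {\<lambda>_. 0}" by (auto simp: poset_partitions_def)
  then have "{f \<in> poset_partitions R {}. weight f = m} = (if m = 0 then {\<lambda>_. 0} else {})"
    by (auto simp: weight_def)
  then show "weight_gf (poset_partitions R {}) $ m = 1 $ m"
    by (simp add: weight_gf_def)
qed

section \<open>The zigzag poset\<close>

text \<open>
  A position is a level together with a flag that is true for the inner part. Larger levels lie
  lower in the poset.
\<close>

definition zigzag :: "((nat \<times> bool) \<times> (nat \<times> bool)) set" where
  "zigzag = {((s, a), (Suc s, b)) | s a b. a \<or> b}"

definition levels :: "nat \<Rightarrow> (nat \<times> bool) set" where
  "levels N = {..<N} \<times> UNIV"

abbreviation zigzag_gf :: "(nat \<times> bool) set \<Rightarrow> rat fps" where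
  "zigzag_gf A \<equiv> weight_gf (poset_partitions zigzag A)"

lemma up_closed_zigzagI:
  "(\<And>s a b. a \<or> b \<Longrightarrow> (Suc s, b) \<in> A \<Longrightarrow> (s, a) \<in> A) \<Longrightarrow> up_closed zigzag A"
  unfolding up_closed_def zigzag_def by blast

lemma zigzag_inner_chain: "s \<le> t \<Longrightarrow> ((s, True), (t, True)) \<in> zigzag\<^sup>*"
proof (induction t rule: dec_induct)
  case (step t)
  have "((t, True), (Suc t, True)) \<in> zigzag" unfolding zigzag_def by blast
  with step.IH show ?case by (rule rtrancl_into_rtrancl)
qed simp

lemma zigzag_above_inner:
  assumes "s < t"
  shows "((s, b), (t, True)) \<in> zigzag\<^sup>*"
proof -
  have "((s, b), (Suc s, True)) \<in> zigzag" unfolding zigzag_def by blast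
  then show ?thesis
    using zigzag_inner_chain[of "Suc s" t] assms
    by (simp add: converse_rtrancl_into_rtrancl)
qed

lemma zigzag_inner_outer: "((t, True), (Suc t, False)) \<in> zigzag\<^sup>*"
  unfolding zigzag_def by blast

lemma zigzag_above_outer: "s < t \<Longrightarrow> ((s, b), (Suc t, False)) \<in> zigzag\<^sup>*"
  using zigzag_above_inner zigzag_inner_outer by (rule rtrancl_trans)

lemma finite_levels [simp]: "finite (levels N)"
  by (simp add: levels_def)

lemma card_levels: "card (levels N) = 2 * N"
  by (simp add: levels_def card_UNIV_bool)

lemma levels_0: "levels 0 = {}"
  by (simp add: levels_def)

lemma levels_Suc: "levels (Suc N) = insert (N, True) (insert (N, False) (levels N))"
  by (auto simp: levels_def UNIV_bool lessThan_Suc)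

lemma mem_levels [simp]: "(t, b) \<in> levels N \<longleftrightarrow> t < N"
  by (simp add: levels_def)

text \<open>
  The lemmas below remove the lowest elements of the four shapes that arise: full levels, full
  levels followed by only an inner or only an outer element, and full levels followed by an inner
  element with an outer one on the level below it. In the last shape the outer element of level \<open>N\<close> is missing, which
  leaves the one of
  level \<open>Suc N\<close> as the only lowest element.
\<close>

lemma zigzag_gf_levels_Suc:
  "(1 - fps_X ^ (2 * N + 2)) * zigzag_gf (levels (Suc N)) =
     zigzag_gf (insert (N, True) (levels N)) + zigzag_gf (insert (N, False) (levels N)) -
     zigzag_gf (levels N)"
proof -
  let ?A = "levels (Suc N)"
  have "(1 - fps_X ^ card ?A) * zigzag_gf ?A =
     zigzag_gf (?A - {(N, False)}) + zigzag_gf (?A - {(N, True)}) -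
     zigzag_gf (?A - {(N, False), (N, True)})"
  proof (rule weight_gf_two_bottoms)
    show "(x, (N, False)) \<in> zigzag\<^sup>* \<or> (x, (N, True)) \<in> zigzag\<^sup>*" if "x \<in> ?A" for x
      using that zigzag_above_inner[of _ N] by (cases x) (auto simp: levels_Suc)
  qed (auto intro: up_closed_zigzagI)
  moreover have "?A - {(N, False)} = insert (N, True) (levels N)"
    "?A - {(N, True)} = insert (N, False) (levels N)"
    "?A - {(N, False), (N, True)} = levels N"
    by (auto simp: levels_Suc)
  moreover have "card ?A = 2 * N + 2"
    by (simp add: card_levels)
  ultimately show ?thesis by simp
qed

lemma zigzag_gf_inner:
  "(1 - fps_X ^ (2 * N + 1)) * zigzag_gf (insert (N, True) (levels N)) = zigzag_gf (levels N)"
proof -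
  let ?A = "insert (N, True) (levels N)"
  have "(1 - fps_X ^ card ?A) * zigzag_gf ?A = zigzag_gf (?A - {(N, True)})"
    by (rule weight_gf_one_bottom)
       (auto intro: up_closed_zigzagI zigzag_above_inner)
  moreover have "?A - {(N, True)} = levels N" by auto
  ultimately show ?thesis by (simp add: card_levels)
qed

lemma zigzag_gf_outer_0:
  "(1 - fps_X) * zigzag_gf (insert (0, False) (levels 0)) = 1"
  using weight_gf_one_bottom[of "{(0, False)}" zigzag "(0, False)"]
  by (simp add: up_closed_def zigzag_def levels_0 weight_gf_poset_partitions_empty)

lemma zigzag_gf_outer_Suc:
  "(1 - fps_X ^ (2 * N + 3)) * zigzag_gf (insert (Suc N, False) (levels (Suc N))) =
     zigzag_gf (levels (Suc N)) +
     zigzag_gf (insert (Suc N, False) (insert (N, True) (levels N))) -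
     zigzag_gf (insert (N, True) (levels N))"
proof -
  let ?A = "insert (Suc N, False) (levels (Suc N))"
  have "(1 - fps_X ^ card ?A) * zigzag_gf ?A =
     zigzag_gf (?A - {(Suc N, False)}) + zigzag_gf (?A - {(N, False)}) -
     zigzag_gf (?A - {(Suc N, False), (N, False)})"
  proof (rule weight_gf_two_bottoms)
    show "(x, (Suc N, False)) \<in> zigzag\<^sup>* \<or> (x, (N, False)) \<in> zigzag\<^sup>*" if "x \<in> ?A" for x
      using that zigzag_above_outer[of _ N] zigzag_inner_outer[of N]
      by (cases x) (auto simp: levels_Suc)
  qed (auto intro: up_closed_zigzagI)
  moreover have "?A - {(Suc N, False)} = levels (Suc N)"
    "?A - {(N, False)} = insert (Suc N, False) (insert (N, True) (levels N))"
    "?A - {(Suc N, False), (N, False)} = insert (N, True) (levels N)"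
    by (auto simp: levels_Suc)
  moreover have "card ?A = 2 * N + 3"
    by (simp add: card_levels)
  ultimately show ?thesis by simp
qed

lemma zigzag_gf_inner_outer:
  "(1 - fps_X ^ (2 * N + 2)) * zigzag_gf (insert (Suc N, False) (insert (N, True) (levels N))) =
     zigzag_gf (insert (N, True) (levels N))"
proof -
  let ?A = "insert (Suc N, False) (insert (N, True) (levels N))"
  have "(1 - fps_X ^ card ?A) * zigzag_gf ?A = zigzag_gf (?A - {(Suc N, False)})"
    by (rule weight_gf_one_bottom)
       (auto intro: up_closed_zigzagI zigzag_above_outer zigzag_inner_outer)
  moreover have "?A - {(Suc N, False)} = insert (N, True) (levels N)" by auto
  ultimately show ?thesis by (simp add: card_levels)
qed

text \<open>The factor clears the denominators that the removal of elements produces.\<close>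

definition zigzag_poly :: "nat \<Rightarrow> rat fps" where
  "zigzag_poly N = q_pochhammer fps_X fps_X (2 * N) * zigzag_gf (levels N)"

lemma q_pochhammer_Suc: "q_pochhammer a q (Suc n) = q_pochhammer a q n * (1 - a * q ^ n)"
  by (simp add: q_pochhammer_def)

lemma zigzag_poly_0: "zigzag_poly 0 = 1"
  by (simp add: zigzag_poly_def levels_0 weight_gf_poset_partitions_empty q_pochhammer_def)

lemma zigzag_poly_1: "zigzag_poly (Suc 0) = 1 + fps_X"
proof -
  let ?E = "zigzag_gf (insert (0, True) (levels 0))"
  let ?H = "zigzag_gf (insert (0, False) (levels 0))"
  have F: "(1 - fps_X ^ 2) * zigzag_gf (levels (Suc 0)) = ?E + ?H - 1"
    and E: "(1 - fps_X) * ?E = 1" and H: "(1 - fps_X) * ?H = 1"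
    using zigzag_gf_levels_Suc[of 0] zigzag_gf_inner[of 0] zigzag_gf_outer_0
    by (simp_all add: levels_0 weight_gf_poset_partitions_empty power2_eq_square)
  have "zigzag_poly (Suc 0) = (1 - fps_X) * ((1 - fps_X ^ 2) * zigzag_gf (levels (Suc 0)))"
    by (simp add: zigzag_poly_def q_pochhammer_def numeral_2_eq_2 mult.assoc)
  also have "\<dots> = (1 - fps_X) * ?E + (1 - fps_X) * ?H - (1 - fps_X)"
    unfolding F by (simp add: algebra_simps)
  finally show ?thesis using E H by simp
qed

text \<open>
  The three intermediate generating functions \<open>E\<close>, \<open>H\<close>, \<open>K\<close> are eliminated from the removal
  equations. These concern sets of \<open>2 * N + 1\<close> to \<open>2 * N + 4\<close> elements, so the factors that they
  bring are the last four of the Pochhammer symbol.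
\<close>

lemma zigzag_poly_rec:
  "zigzag_poly (Suc (Suc N)) =
     (1 + fps_X ^ (2 * N + 3)) * zigzag_poly (Suc N) + fps_X ^ (2 * N + 2) * zigzag_poly N"
proof -
  let ?Q = "\<lambda>k. q_pochhammer fps_X fps_X k :: rat fps"
  let ?F = "\<lambda>N. zigzag_gf (levels N)"
  let ?E = "\<lambda>N. zigzag_gf (insert (N, True) (levels N))"
  let ?H = "zigzag_gf (insert (Suc N, False) (levels (Suc N)))"
  let ?K = "zigzag_gf (insert (Suc N, False) (insert (N, True) (levels N)))"
  define a b c d :: "rat fps"
    where "a = fps_X ^ (2 * N + 1)" and "b = fps_X ^ (2 * N + 2)"
      and "c = fps_X ^ (2 * N + 3)" and "d = fps_X ^ (2 * N + 4)"
  have Q2: "?Q (2 * Suc N) = ?Q (2 * N) * (1 - a) * (1 - b)"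
    by (simp add: q_pochhammer_Suc a_def b_def)
  have Q4: "?Q (2 * Suc (Suc N)) = ?Q (2 * Suc N) * (1 - c) * (1 - d)"
    by (simp add: q_pochhammer_Suc c_def d_def numeral_3_eq_3 numeral_eq_Suc)
  have F: "(1 - d) * ?F (Suc (Suc N)) = ?E (Suc N) + ?H - ?F (Suc N)"
    using zigzag_gf_levels_Suc[of "Suc N"] by (simp add: d_def numeral_eq_Suc)
  have E1: "(1 - c) * ?E (Suc N) = ?F (Suc N)"
    using zigzag_gf_inner[of "Suc N"] by (simp add: c_def numeral_eq_Suc)
  have H: "(1 - c) * ?H = ?F (Suc N) + ?K - ?E N"
    using zigzag_gf_outer_Suc[of N] by (simp add: c_def)
  have K: "(1 - b) * ?K = ?E N"
    using zigzag_gf_inner_outer[of N] by (simp add: b_def)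
  have E0: "(1 - a) * ?E N = ?F N"
    using zigzag_gf_inner[of N] by (simp add: a_def)
  have "zigzag_poly (Suc (Suc N)) = ?Q (2 * Suc N) * ((1 - c) * ((1 - d) * ?F (Suc (Suc N))))"
    unfolding zigzag_poly_def Q4 by (simp only: mult.assoc)
  also have "(1 - c) * ((1 - d) * ?F (Suc (Suc N))) =
      (1 - c) * ?E (Suc N) + (1 - c) * ?H - (1 - c) * ?F (Suc N)"
    unfolding F by (simp add: algebra_simps)
  also have "\<dots> = (1 + c) * ?F (Suc N) + (?K - ?E N)"
    unfolding E1 H by (simp add: algebra_simps)
  also have "?Q (2 * Suc N) * \<dots> =
      (1 + c) * zigzag_poly (Suc N) + ?Q (2 * N) * (1 - a) * ((1 - b) * ?K - (1 - b) * ?E N)"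
    unfolding zigzag_poly_def Q2 by (simp add: algebra_simps)
  also have "?Q (2 * N) * (1 - a) * ((1 - b) * ?K - (1 - b) * ?E N) =
      b * (?Q (2 * N) * ((1 - a) * ?E N))"
    unfolding K by (simp add: algebra_simps)
  also have "\<dots> = b * zigzag_poly N"
    unfolding E0 zigzag_poly_def ..
  finally show ?thesis by (simp add: b_def c_def)
qed

section \<open>Double shifted plane partitions of profile 010\<close>

text \<open>
  In the chain of interlacings 0-1-2-3, the partitions 1 and 2 have two neighbours each and become
  the inner parts; 0 and 3 have one neighbour each and become the outer parts.
\<close>

definition dspp_of_zigzag :: "(nat \<times> bool \<Rightarrow> nat) \<Rightarrow> partition4" where
  "dspp_of_zigzag f =
     (\<lambda>i. f (2 * i, False), \<lambda>i. f (2 * i + 1, True),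
      \<lambda>i. f (2 * i, True), \<lambda>i. f (2 * i + 1, False))"

lemma num_parts_le_iff:
  assumes "is_partition p"
  shows "num_parts p \<le> n \<longleftrightarrow> (\<forall>i\<ge>n. p i = 0)"
proof
  have fin: "finite {i. p i > 0}" and anti: "antimono p"
    using assms by (auto simp: is_partition_def)
  show "\<forall>i\<ge>n. p i = 0" if le: "num_parts p \<le> n"
  proof (intro allI impI, rule ccontr)
    fix i assume "i \<ge> n" "p i \<noteq> 0"
    then have "{..i} \<subseteq> {i. p i > 0}"
      using antimonoD[OF anti] by (auto intro: less_le_trans)
    from card_mono[OF fin this] show False
      using le \<open>i \<ge> n\<close> by (simp add: num_parts_def)
  qed
  show "num_parts p \<le> n" if "\<forall>i\<ge>n. p i = 0"
  proof -
    have "{i. p i > 0} \<subseteq> {..<n}" using that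
      by (metis lessThan_iff mem_Collect_eq not_less neq0_conv subsetI)
    from card_mono[OF _ this] show ?thesis by (simp add: num_parts_def)
  qed
qed

lemma zigzag_step:
  assumes "f \<in> poset_partitions zigzag A" "a \<or> b"
  shows "f (Suc s, b) \<le> f (s, a)"
  using assms unfolding poset_partitions_def zigzag_def by blast

lemma sum_lessThan_double: "(\<Sum>t<2 * n. g t) = (\<Sum>i<n. g (2 * i) + g (2 * i + 1 :: nat))"
  for g :: "nat \<Rightarrow> 'a::comm_monoid_add"
  by (induction n) (simp_all add: add_ac)

lemma dspp_size_dspp_of_zigzag:
  assumes "f \<in> poset_partitions zigzag (levels (2 * n))"
  shows "dspp_size (dspp_of_zigzag f) = weight f"
proof -
  have zero: "f (t, b) = 0" if "t \<ge> 2 * n" for t b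
    using assms that by (auto simp: poset_partitions_def)
  have parts: "sum_parts p = (\<Sum>i<n. p i)" if "\<And>i. i \<ge> n \<Longrightarrow> p i = 0" for p
    using weight_eq_sum[of "{..<n}" p] that by (simp add: sum_parts_def weight_def)
  have "weight f = (\<Sum>t<2 * n. f (t, False) + f (t, True))"
  proof -
    have "weight f = sum f (levels (2 * n))"
      using assms by (intro weight_eq_sum) (auto simp: poset_partitions_def)
    also have "\<dots> = (\<Sum>t<2 * n. \<Sum>b\<in>UNIV. f (t, b))"
      by (simp add: levels_def sum.cartesian_product)
    finally show ?thesis by (simp add: UNIV_bool)
  qed
  also have "\<dots> = dspp_size (dspp_of_zigzag f)"
    using zero by (simp add: sum_lessThan_double dspp_of_zigzag_def parts sum.distrib)
  finally show ?thesis ..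
qed

lemma bij_betw_dspp_of_zigzag:
  "bij_betw dspp_of_zigzag (poset_partitions zigzag (levels (2 * n))) (DSPP (0, 1, 0) n)"
proof (rule bij_betwI')
  fix f g :: "nat \<times> bool \<Rightarrow> nat"
  show "dspp_of_zigzag f = dspp_of_zigzag g \<longleftrightarrow> f = g"
  proof
    assume eq: "dspp_of_zigzag f = dspp_of_zigzag g"
    have "f (t, b) = g (t, b)" for t b
      using eq by (cases b; cases "even t")
        (auto simp: dspp_of_zigzag_def fun_eq_iff elim!: evenE oddE)
    then show "f = g" by auto
  qed simp
next
  fix f assume f: "f \<in> poset_partitions zigzag (levels (2 * n))"
  have zero: "f (t, b) = 0" if "t \<ge> 2 * n" for t b
    using f that by (auto simp: poset_partitions_def)
  note step = zigzag_step[OF f]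
  have part: "is_partition (\<lambda>i. f (2 * i + e, b)) \<and> num_parts (\<lambda>i. f (2 * i + e, b)) \<le> n"
    for e b
  proof -
    \<comment> \<open>Outer parts are compared through the inner part of the level between them.\<close>
    have "f (2 * Suc i + e, b) \<le> f (2 * i + e, b)" for i
      using step[of b True "2 * i + e"] step[of True b "Suc (2 * i + e)"] by simp
    note le = lift_Suc_antimono_le[of "\<lambda>i. f (2 * i + e, b)", OF this]
    have anti: "antimono (\<lambda>i. f (2 * i + e, b))"
      by (rule antimonoI) (rule le)
    have "i < n" if "f (2 * i + e, b) > 0" for i
      using that zero[of "2 * i + e" b] by (cases "i < n") simp_all
    then have "{i. f (2 * i + e, b) > 0} \<subseteq> {..<n}" by blast
    then have "finite {i. f (2 * i + e, b) > 0}"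
      by (rule finite_subset) simp
    with anti have p: "is_partition (\<lambda>i. f (2 * i + e, b))"
      by (simp add: is_partition_def)
    then show ?thesis using zero by (simp add: num_parts_le_iff)
  qed
  show "dspp_of_zigzag f \<in> DSPP (0, 1, 0) n"
    using part[of 0] part[of 1] step
    by (auto simp: DSPP_def dspp_of_zigzag_def profile_step_def interlaces_def)
next
  fix L assume L: "L \<in> DSPP (0, 1, 0) n"
  obtain p0 p1 p2 p3 where Lp: "L = (p0, p1, p2, p3)" by (cases L) auto
  define f where "f = (\<lambda>(t, b). if even t then (if b then p2 else p0) (t div 2)
                               else (if b then p1 else p3) (t div 2))"
  have part: "is_partition p0" "is_partition p1" "is_partition p2" "is_partition p3"
    and num: "num_parts p0 \<le> n" "num_parts p1 \<le> n" "num_parts p2 \<le> n" "num_parts p3 \<le> n"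
    and inter: "interlaces p0 p1" "interlaces p2 p1" "interlaces p2 p3"
    using L by (auto simp: DSPP_def Lp profile_step_def)
  have zero: "p0 i = 0" "p1 i = 0" "p2 i = 0" "p3 i = 0" if "i \<ge> n" for i
    using num part that by (auto simp: num_parts_le_iff)
  have "f (Suc s, b) \<le> f (s, a)" if "a \<or> b" for s a b
    using that inter by (cases "even s") (auto simp: f_def interlaces_def elim!: evenE oddE)
  then have "f \<in> poset_partitions zigzag (levels (2 * n))"
    using zero by (auto simp: poset_partitions_def zigzag_def f_def levels_def)
  moreover have "L = dspp_of_zigzag f"
    by (simp add: Lp dspp_of_zigzag_def f_def)
  ultimately show "\<exists>f \<in> poset_partitions zigzag (levels (2 * n)). L = dspp_of_zigzag f" by blast
qed

lemma P_010_eq_zigzag_poly: "P_010 n = zigzag_poly (2 * n)"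
proof -
  let ?S = "poset_partitions zigzag (levels (2 * n))"
  have "card {f \<in> ?S. weight f = m} = card {L \<in> DSPP (0, 1, 0) n. dspp_size L = m}" for m
  proof (rule bij_betw_same_card)
    show "bij_betw dspp_of_zigzag {f \<in> ?S. weight f = m}
            {L \<in> DSPP (0, 1, 0) n. dspp_size L = m}"
      by (rule bij_betw_Collect[OF bij_betw_dspp_of_zigzag]) (simp add: dspp_size_dspp_of_zigzag)
  qed
  then have "F_DSPP (0, 1, 0) n = zigzag_gf (levels (2 * n))"
    by (simp add: F_DSPP_def weight_gf_def)
  then show ?thesis by (simp add: P_010_def zigzag_poly_def)
qed

section \<open>The double sum\<close>

lemma q_pochhammer_base_nth_0:
  fixes q :: "rat fps"
  assumes "q $ 0 = 0"
  shows "q_pochhammer q q n $ 0 = 1"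
  using assms by (induction n) (simp_all add: q_pochhammer_Suc, simp add: q_pochhammer_def)

lemma q_pochhammer_base_nonzero:
  fixes q :: "rat fps"
  assumes "q $ 0 = 0"
  shows "q_pochhammer q q n \<noteq> 0"
  using q_pochhammer_base_nth_0[OF assms, of n] by auto

lemma q_binomial_eq_0: "m < 0 \<or> n < m \<Longrightarrow> q_binomial q n m = 0"
  by (auto simp: q_binomial_def)

lemma q_binomial_times:
  assumes q: "q $ 0 = 0" and "m \<le> n"
  shows "q_binomial q (int n) (int m) * (q_pochhammer q q m * q_pochhammer q q (n - m)) =
         q_pochhammer q q n"
proof -
  let ?d = "q_pochhammer q q m * q_pochhammer q q (n - m)"
  have "?d $ 0 = 1"
    by (simp add: q_pochhammer_base_nth_0[OF q])
  then have "is_unit ?d" by simp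
  then show ?thesis
    using assms by (simp add: q_binomial_def nat_diff_distrib flip: of_nat_diff)
qed

lemma q_binomial_0_right:
  assumes "q $ 0 = 0"
  shows "q_binomial q (int n) 0 = 1"
proof -
  have "q_binomial q (int n) 0 * q_pochhammer q q n = 1 * q_pochhammer q q n"
    using q_binomial_times[OF assms, of 0 n] by (simp add: q_pochhammer_def)
  then show ?thesis
    using q_pochhammer_base_nonzero[OF assms, of n] by (metis mult_right_cancel)
qed

lemma q_binomial_self:
  assumes "q $ 0 = 0"
  shows "q_binomial q (int n) (int n) = 1"
proof -
  have "q_binomial q (int n) (int n) * q_pochhammer q q n = 1 * q_pochhammer q q n"
    using q_binomial_times[OF assms, of n n] by (simp add: q_pochhammer_def)
  then show ?thesis
    using q_pochhammer_base_nonzero[OF assms, of n] by (metis mult_right_cancel)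
qed

text \<open>
  After multiplication by the common denominator, both $q$-Pascal rules are decompositions of
  $1 - q^{n+1}$ into multiples of $1 - q^{m+1}$ and $1 - q^{n-m}$.
\<close>

lemma q_binomial_Suc_Suc:
  assumes q: "q $ 0 = 0"
  shows "q_binomial q (int (Suc n)) (int (Suc m)) =
           q_binomial q (int n) (int (Suc m)) + q ^ (n - m) * q_binomial q (int n) (int m)"
    (is ?left)
    and "q_binomial q (int (Suc n)) (int (Suc m)) =
           q ^ Suc m * q_binomial q (int n) (int (Suc m)) + q_binomial q (int n) (int m)"
    (is ?right)
proof -
  consider "n < m" | "n = m" | d where "n = m + Suc d"
    using less_iff_Suc_add[of m n] by fastforce
  then have "?left \<and> ?right"
  proof cases
    case 1
    then show ?thesis by (simp add: q_binomial_eq_0)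
  next
    case 2
    then show ?thesis using q by (simp add: q_binomial_eq_0 q_binomial_self del: of_nat_Suc)
  next
    case 3
    let ?P = "q_pochhammer q q"
    let ?D = "?P (Suc m) * ?P (Suc d)"
    have top: "q_binomial q (int (Suc n)) (int (Suc m)) * ?D = (1 - q ^ Suc n) * ?P n"
    proof -
      have "Suc n - Suc m = Suc d" "Suc m \<le> Suc n" using 3 by simp_all
      then show ?thesis
        using q_binomial_times[OF q, of "Suc m" "Suc n"]
        by (simp only: q_pochhammer_Suc[of q q n] mult.commute power_Suc)
    qed
    have left: "q_binomial q (int n) (int (Suc m)) * ?D = (1 - q ^ Suc d) * ?P n"
      using q_binomial_times[OF q, of "Suc m" n] 3
      by (simp add: q_pochhammer_Suc[of _ _ d] mult_ac del: of_nat_Suc)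
    have right: "q_binomial q (int n) (int m) * ?D = (1 - q ^ Suc m) * ?P n"
      using q_binomial_times[OF q, of m n] 3
      by (simp add: q_pochhammer_Suc[of _ _ m] mult_ac del: of_nat_Suc)
    have nz: "?D \<noteq> 0"
      using q_pochhammer_base_nonzero[OF q] by simp
    have pow: "q ^ Suc n = q ^ Suc m * q ^ Suc d"
      using 3 by (simp add: power_add mult_ac)
    have "q_binomial q (int (Suc n)) (int (Suc m)) * ?D =
        (q_binomial q (int n) (int (Suc m)) + q ^ (n - m) * q_binomial q (int n) (int m)) * ?D"
      unfolding distrib_right mult.assoc top left right pow
      using 3 by (simp add: algebra_simps)
    moreover have "q_binomial q (int (Suc n)) (int (Suc m)) * ?D =
        (q ^ Suc m * q_binomial q (int n) (int (Suc m)) + q_binomial q (int n) (int m)) * ?D"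
      unfolding distrib_right mult.assoc top left right pow
      by (simp add: algebra_simps)
    ultimately show ?thesis
      using nz by (simp only: mult_right_cancel) simp
  qed
  then show ?left ?right by auto
qed

text \<open>
  Here \<open>N\<close> takes the place of $2n$, because the recurrence also needs odd values.
\<close>

definition double_sum_term :: "nat \<Rightarrow> nat \<Rightarrow> nat \<Rightarrow> rat fps" where
  "double_sum_term N j k = fps_X ^ (j\<^sup>2 + k\<^sup>2) * q_binomial (fps_X ^ 2) (int N - int k) (int j) *
     q_binomial (fps_X ^ 2) (int j) (int k)"

definition double_sum :: "nat \<Rightarrow> rat fps" where
  "double_sum N = (\<Sum>j\<le>N. \<Sum>k\<le>N. double_sum_term N j k)"

lemma double_sum_term_eq_0: "N < j \<or> N < k \<or> j < k \<Longrightarrow> double_sum_term N j k = 0"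
  by (auto simp: double_sum_term_def q_binomial_eq_0)

lemma double_sum_larger_range:
  assumes "N \<le> M"
  shows "double_sum N = (\<Sum>j\<le>M. \<Sum>k\<le>M. double_sum_term N j k)"
proof -
  have "double_sum N = (\<Sum>j\<le>N. \<Sum>k\<le>M. double_sum_term N j k)"
    unfolding double_sum_def
    using assms by (intro sum.cong sum.mono_neutral_left) (auto simp: double_sum_term_eq_0)
  also have "\<dots> = (\<Sum>j\<le>M. \<Sum>k\<le>M. double_sum_term N j k)"
    using assms by (intro sum.mono_neutral_left) (auto simp: double_sum_term_eq_0)
  finally show ?thesis .
qed

lemma double_sum_term_0_left: "double_sum_term N 0 k = (if k = 0 then 1 else 0)"
proof -
  have "double_sum_term N 0 0 = 1"
    using q_binomial_0_right[of "fps_X ^ 2" N] q_binomial_0_right[of "fps_X ^ 2" 0]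
    by (simp add: double_sum_term_def)
  then show ?thesis by (simp add: double_sum_term_eq_0)
qed

text \<open>
  The first rule for ${N+2-k \brack j+1}_{q^2}$ gives the term for \<open>Suc N\<close> and a remainder
  with ${N+1-k \brack j}_{q^2} {j+1 \brack k}_{q^2}$, whose second factor is then split by the
  second rule. The squares in the exponent of $q$ absorb the powers that the two rules produce.
\<close>

lemma double_sum_term_rec:
  "double_sum_term (Suc (Suc N)) (Suc j) k =
     double_sum_term (Suc N) (Suc j) k + fps_X ^ (2 * N + 3) * double_sum_term (Suc N) j k +
     (case k of 0 \<Rightarrow> 0 | Suc l \<Rightarrow> fps_X ^ (2 * N + 2) * double_sum_term N j l)"
proof (cases "k \<le> Suc N \<and> j \<le> Suc N - k")
  case False
  \<comment> \<open>Every term vanishes here: the upper index, possibly negative, is too small, or \<open>j < k\<close>.\<close>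
  then have zero: "int (Suc (Suc N)) - int k < int (Suc j)" "int (Suc N) - int k < int (Suc j)"
    "int (Suc N) - int k < int j \<or> j < k"
    by linarith+
  have "double_sum_term N j l = 0" if "k = Suc l" for l
    using zero that by (auto simp: double_sum_term_def q_binomial_eq_0)
  then show ?thesis
    using zero by (auto simp: double_sum_term_def q_binomial_eq_0 split: nat.split)
next
  case True
  define B where "B = q_binomial (fps_X ^ 2 :: rat fps)"
  define a where "a = Suc N - k"
  have q: "(fps_X ^ 2 :: rat fps) $ 0 = 0" by simp
  have a: "j \<le> a" "Suc N = a + k" using True by (auto simp: a_def)
  have pow: "fps_X ^ ((Suc j)\<^sup>2 + k\<^sup>2) * (fps_X ^ 2) ^ (a - j) = (fps_X ^ e :: rat fps)"
    if "e + 2 * k = j\<^sup>2 + k\<^sup>2 + 2 * N + 3" for e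
  proof -
    have "(Suc j)\<^sup>2 + k\<^sup>2 + 2 * (a - j) = e"
      using that a by (simp add: power2_eq_square algebra_simps)
    then show ?thesis by (simp only: flip: power_mult power_add)
  qed
  have "double_sum_term (Suc (Suc N)) (Suc j) k - double_sum_term (Suc N) (Suc j) k =
      fps_X ^ ((Suc j)\<^sup>2 + k\<^sup>2) * (B (int (Suc a)) (int (Suc j)) - B (int a) (int (Suc j))) *
      B (int (Suc j)) (int k)"
  proof -
    have "int (Suc (Suc N)) - int k = int (Suc a)" "int (Suc N) - int k = int a"
      using a by simp_all
    then show ?thesis
      unfolding double_sum_term_def B_def by (simp only: right_diff_distrib left_diff_distrib)
  qed
  also have "\<dots> = (fps_X ^ ((Suc j)\<^sup>2 + k\<^sup>2) * (fps_X ^ 2) ^ (a - j)) * (B (int a) (int j) *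
      B (int (Suc j)) (int k))"
    unfolding B_def q_binomial_Suc_Suc(1)[OF q] by (simp only: add_diff_cancel_left' mult_ac)
  also have "\<dots> = fps_X ^ (2 * N + 3) * double_sum_term (Suc N) j k +
     (case k of 0 \<Rightarrow> 0 | Suc l \<Rightarrow> fps_X ^ (2 * N + 2) * double_sum_term N j l)"
  proof (cases k)
    case 0
    have "B (int (Suc j)) (int k) = 1" "B (int j) (int k) = 1"
      unfolding B_def 0 using q_binomial_0_right[OF q] by (simp_all del: of_nat_Suc)
    moreover have "double_sum_term (Suc N) j k = fps_X ^ (j\<^sup>2) * B (int a) (int j) * B (int j) (int k)"
      unfolding double_sum_term_def B_def using a 0 by simp
    moreover have "fps_X ^ ((Suc j)\<^sup>2 + k\<^sup>2) * (fps_X ^ 2) ^ (a - j) =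
        fps_X ^ (2 * N + 3) * (fps_X ^ (j\<^sup>2) :: rat fps)"
      by (subst pow[of "2 * N + 3 + j\<^sup>2"]) (simp_all add: 0 power_add)
    ultimately show ?thesis using 0 by (simp add: mult.assoc)
  next
    case (Suc l)
    have up: "fps_X ^ ((Suc j)\<^sup>2 + k\<^sup>2) * (fps_X ^ 2) ^ (a - j) * (fps_X ^ 2) ^ k =
        fps_X ^ (2 * N + 3) * (fps_X ^ (j\<^sup>2 + k\<^sup>2) :: rat fps)"
    proof -
      have "(Suc j)\<^sup>2 + k\<^sup>2 + 2 * (a - j) + 2 * k = 2 * N + 3 + (j\<^sup>2 + k\<^sup>2)"
        using a by (simp add: power2_eq_square algebra_simps)
      then show ?thesis by (simp only: flip: power_mult power_add)
    qed
    have down: "fps_X ^ ((Suc j)\<^sup>2 + k\<^sup>2) * (fps_X ^ 2) ^ (a - j) =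
        fps_X ^ (2 * N + 2) * (fps_X ^ (j\<^sup>2 + l\<^sup>2) :: rat fps)"
      by (subst pow[of "2 * N + 2 + (j\<^sup>2 + l\<^sup>2)"])
         (simp_all add: Suc power2_eq_square flip: power_add)
    have "int (Suc N) - int k = int a" "int N - int l = int a"
      using a Suc by simp_all
    then have terms:
      "double_sum_term (Suc N) j k = fps_X ^ (j\<^sup>2 + k\<^sup>2) * B (int a) (int j) * B (int j) (int k)"
      "double_sum_term N j l = fps_X ^ (j\<^sup>2 + l\<^sup>2) * B (int a) (int j) * B (int j) (int l)"
      unfolding double_sum_term_def B_def by (simp_all only:)
    let ?c = "fps_X ^ ((Suc j)\<^sup>2 + k\<^sup>2) * (fps_X ^ 2) ^ (a - j) :: rat fps"
    have "?c * (B (int a) (int j) * B (int (Suc j)) (int k)) =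
        (?c * (fps_X ^ 2) ^ k) * (B (int a) (int j) * B (int j) (int k)) +
        ?c * (B (int a) (int j) * B (int j) (int l))"
      unfolding Suc B_def q_binomial_Suc_Suc(2)[OF q] by (simp only: distrib_left mult_ac)
    also have "\<dots> = fps_X ^ (2 * N + 3) * double_sum_term (Suc N) j k +
        fps_X ^ (2 * N + 2) * double_sum_term N j l"
      unfolding up unfolding down terms by (simp only: mult_ac)
    finally show ?thesis unfolding Suc by simp
  qed
  finally show ?thesis by (simp add: algebra_simps)
qed

lemma double_sum_rec:
  "double_sum (Suc (Suc N)) =
     (1 + fps_X ^ (2 * N + 3)) * double_sum (Suc N) + fps_X ^ (2 * N + 2) * double_sum N"
proof -
  let ?M = "Suc (Suc N)"
  let ?c = "fps_X ^ (2 * N + 3) :: rat fps" and ?d = "fps_X ^ (2 * N + 2) :: rat fps"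
  have shift: "(\<Sum>k\<le>?M. case k of 0 \<Rightarrow> 0 | Suc l \<Rightarrow> ?d * double_sum_term N j l) =
      ?d * (\<Sum>k\<le>Suc N. double_sum_term N j k)" for j
    unfolding sum.atMost_Suc_shift[of _ "Suc N"] by (simp only: sum_distrib_left nat.case add_0_left)
  have row: "(\<Sum>k\<le>?M. double_sum_term (Suc N) j k) = (\<Sum>k\<le>Suc N. double_sum_term (Suc N) j k)" for j
    by (simp add: double_sum_term_eq_0)
  have "double_sum ?M = (\<Sum>k\<le>?M. double_sum_term ?M 0 k) +
      (\<Sum>j\<le>Suc N. \<Sum>k\<le>?M. double_sum_term ?M (Suc j) k)"
    unfolding double_sum_def by (rule sum.atMost_Suc_shift)
  also have "(\<Sum>k\<le>?M. double_sum_term ?M 0 k) = (\<Sum>k\<le>?M. double_sum_term (Suc N) 0 k)"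
    by (simp only: double_sum_term_0_left)
  also have "(\<Sum>j\<le>Suc N. \<Sum>k\<le>?M. double_sum_term ?M (Suc j) k) =
      (\<Sum>j\<le>Suc N. \<Sum>k\<le>?M. double_sum_term (Suc N) (Suc j) k) +
      ?c * (\<Sum>j\<le>Suc N. \<Sum>k\<le>Suc N. double_sum_term (Suc N) j k) +
      ?d * (\<Sum>j\<le>Suc N. \<Sum>k\<le>Suc N. double_sum_term N j k)"
    unfolding double_sum_term_rec sum.distrib shift sum_distrib_left[symmetric] row ..
  also have "(\<Sum>k\<le>?M. double_sum_term (Suc N) 0 k) + \<dots> =
      (\<Sum>j\<le>?M. \<Sum>k\<le>?M. double_sum_term (Suc N) j k) +
      ?c * (\<Sum>j\<le>Suc N. \<Sum>k\<le>Suc N. double_sum_term (Suc N) j k) +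
      ?d * (\<Sum>j\<le>Suc N. \<Sum>k\<le>Suc N. double_sum_term N j k)"
    unfolding sum.atMost_Suc_shift[of "\<lambda>j. \<Sum>k\<le>?M. double_sum_term (Suc N) j k"]
    by (simp only: add.assoc)
  also have "\<dots> = double_sum (Suc N) + ?c * double_sum (Suc N) + ?d * double_sum N"
    using double_sum_larger_range[of "Suc N" ?M] double_sum_larger_range[of N "Suc N"]
    by (simp only: double_sum_def)
  finally show ?thesis by (simp add: distrib_right)
qed

lemma double_sum_0: "double_sum 0 = 1"
  by (simp add: double_sum_def double_sum_term_0_left)

lemma double_sum_1: "double_sum (Suc 0) = 1 + fps_X"
proof -
  have q: "(fps_X ^ 2 :: rat fps) $ 0 = 0" by simp
  have "double_sum_term (Suc 0) (Suc 0) 0 = fps_X"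
    using q_binomial_self[OF q, of 1] q_binomial_0_right[OF q, of 1]
    by (simp add: double_sum_term_def)
  moreover have "double_sum_term (Suc 0) (Suc 0) (Suc 0) = 0"
    by (simp add: double_sum_term_def q_binomial_eq_0)
  ultimately show ?thesis by (simp add: double_sum_def double_sum_term_0_left)
qed

lemma zigzag_poly_eq_double_sum: "zigzag_poly N = double_sum N"
  by (induction N rule: induct_nat_012)
     (simp_all only: zigzag_poly_0 zigzag_poly_1 zigzag_poly_rec double_sum_0 double_sum_1 double_sum_rec)

theorem theorem3p5:
  fixes n :: nat
  shows "((\<lambda>(j, k). fps_X ^ (j^2 + k^2) *
             q_binomial (fps_X ^ 2) (2 * int n - int k) (int j) *
             q_binomial (fps_X ^ 2) (int j) (int k))
          has_sum P_010 n) (UNIV :: (nat \<times> nat) set)"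
proof -
  have "((\<lambda>(j, k). double_sum_term (2 * n) j k) has_sum P_010 n) UNIV"
  proof (rule has_sum_finite_neutralI)
    show "P_010 n = (\<Sum>(j, k) \<in> {..2 * n} \<times> {..2 * n}. double_sum_term (2 * n) j k)"
      by (simp add: P_010_eq_zigzag_poly zigzag_poly_eq_double_sum double_sum_def sum.cartesian_product)
  qed (auto intro: ccontr simp: double_sum_term_eq_0)
  then show ?thesis by (simp add: double_sum_term_def)
qed

end
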